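(* Let $n\ge k$ be positive integers, $f_k$ the $k$-clique Boolean function on $n$ vertices, $X_k$ the set of the $\binom k2$ edge variables among some fixed set of $k$ vertices, and $y\notin X_k$ another edge variable. Then $\mathrm{Aut}(f_k^{restricted}(X_k,y))\not\cong S_{\binom k2+1}$.
   Context: The $k$-clique function $f_k$ takes as input a graph on vertex set $\{1,\dots,n\}$ encoded by $\binom n2$ bits $e_{ij}$ ($i<j$), $e_{ij}=1$ meaning the edge $\{i,j\}$ is present; $f_k=1$ iff the graph contains a clique on $k$ vertices. For a Boolean function $f$ and a subset $X$ of its variables, $f^{restricted}(X)$ denotes the Boolean function of the variables in $X$ obtained from $f$ by assigning the value $0$ to every variable not in $X$; $f_k^{restricted}(X_k,y)$ means $f_k^{restricted}(X_k\cup\{y\})$. For a Boolean function $g$ of variables $y_1,\dots,y_m$, $\mathrm{Aut}(g)$ is the group of permutations $\sigma\in S_m$ with $g(y_{\sigma(1)},\dots,y_{\sigma(m)})=g(y_1,\dots,y_m)$ for all inputs.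
   Formalization: The formal theorem assumes k ≥ 3 instead of k ≥ 1: for k = 1 the restricted function is constant with automorphism group S_1, and for k = 2 it is x OR y with group S_2, so the claim fails in every case with k = 1 or k = 2. *)

theory Defs
  imports "HOL-Algebra.Sym_Groups"
begin

text \<open>A Boolean function of variables indexed by \<open>'v\<close> has type \<open>('v \<Rightarrow> bool) \<Rightarrow> bool\<close>; its inputs are
  the assignments \<open>'v \<Rightarrow> bool\<close>. The edge variable \<open>e\<^sub>i\<^sub>j\<close> (\<open>i < j\<close>) is the pair \<open>(i, j)\<close>.\<close>

definition edge_vars :: "nat set \<Rightarrow> (nat \<times> nat) set" where
  "edge_vars U = {(i, j). i \<in> U \<and> j \<in> U \<and> i < j}"

definition clique_fun :: "nat \<Rightarrow> nat \<Rightarrow> (nat \<times> nat \<Rightarrow> bool) \<Rightarrow> bool" where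
  "clique_fun n k e \<longleftrightarrow>
     (\<exists>S. S \<subseteq> {1..n} \<and> card S = k \<and> (\<forall>i\<in>S. \<forall>j\<in>S. i < j \<longrightarrow> e (i, j)))"

text \<open>The result ignores the values of its input outside \<open>X\<close>, so it is a function of the variables
  in \<open>X\<close> only.\<close>

definition restricted :: "(('v \<Rightarrow> bool) \<Rightarrow> bool) \<Rightarrow> 'v set \<Rightarrow> ('v \<Rightarrow> bool) \<Rightarrow> bool" where
  "restricted f X = (\<lambda>a. f (\<lambda>v. if v \<in> X then a v else False))"

text \<open>For a function \<open>g\<close> of the variables in \<open>V\<close>. The case \<open>V = {1..m}\<close> gives the subgroup of
  \<open>sym_group m\<close> fixing \<open>g\<close>; for other \<open>V\<close> the variables themselves are permuted instead of their
  positions in some enumeration \<open>y\<^sub>1, \<dots>, y\<^sub>m\<close>.\<close>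

definition Aut :: "'v set \<Rightarrow> (('v \<Rightarrow> bool) \<Rightarrow> bool) \<Rightarrow> ('v \<Rightarrow> 'v) monoid" where
  "Aut V g = \<lparr> carrier = {\<sigma>. \<sigma> permutes V \<and> (\<forall>a. g (\<lambda>v. a (\<sigma> v)) = g a)},
               mult = (\<circ>), one = id \<rparr>"

text \<open>The hypothesis \<open>3 \<le> k\<close> cannot be relaxed to \<open>1 \<le> k\<close>. For \<open>k = 1\<close> the restricted
  function of the single variable \<open>y\<close> is constantly true, with automorphism group \<open>S\<^sub>1\<close>; for
  \<open>k = 2\<close> it is the disjunction of two variables, with automorphism group \<open>S\<^sub>2\<close>. In both
  cases the group is the symmetric group of degree \<open>(k choose 2) + 1\<close>.\<close>

end

theory Submission
  imports Defs
begin

text \<open>A vertex outside \<open>K\<close> has degree at most one in the complete graph on \<open>K\<close> extended by the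
  edge \<open>y\<close>, so for \<open>k \<ge> 3\<close> the only \<open>k\<close>-clique is \<open>K\<close> itself and the restricted function is the
  conjunction of the variables of \<open>K\<close>. Exchanging \<open>y\<close> with one of them is not an automorphism,
  hence the automorphism group is a proper subset of the permutations of \<open>(k choose 2) + 1\<close>
  variables and is too small to be isomorphic to the full symmetric group.\<close>

lemma card_edge_vars:
  assumes "finite U"
  shows "card (edge_vars U) = card U choose 2"
proof -
  \<comment> \<open>Each two-element subset has exactly one increasing ordering, so edge variables
    can be counted as unordered pairs.\<close>
  have "bij_betw (\<lambda>(i, j). {i, j}) (edge_vars U) {B. B \<subseteq> U \<and> card B = 2}"
    unfolding bij_betw_def
  proof
    show "inj_on (\<lambda>(i, j). {i, j}) (edge_vars U)"
      by (auto simp: inj_on_def edge_vars_def doubleton_eq_iff)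
    have "B \<in> (\<lambda>(i, j). {i, j}) ` edge_vars U" if B: "B \<subseteq> U" "card B = 2" for B
    proof -
      obtain u v where uv: "B = {u, v}" "u \<noteq> v"
        using B(2) by (auto simp: card_2_iff)
      then have "B = (\<lambda>(i, j). {i, j}) (min u v, max u v)" "(min u v, max u v) \<in> edge_vars U"
        using B(1) by (auto simp: edge_vars_def min_def max_def)
      then show ?thesis by (rule image_eqI)
    qed
    then show "(\<lambda>(i, j). {i, j}) ` edge_vars U = {B. B \<subseteq> U \<and> card B = 2}"
      by (auto simp: edge_vars_def)
  qed
  then have "card (edge_vars U) = card {B. B \<subseteq> U \<and> card B = 2}"
    by (rule bij_betw_same_card)
  then show ?thesis
    by (simp add: n_subsets assms)
qed

lemma finite_edge_vars:
  assumes "finite U"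
  shows "finite (edge_vars U)"
  by (rule finite_subset[of _ "U \<times> U"]) (auto simp: edge_vars_def assms)

lemma clique_in_complete_graph_plus_edge:
  assumes "3 \<le> card K" and "card S = card K"
    and edges: "edge_vars S \<subseteq> edge_vars K \<union> {y}"
  shows "S = K"
proof -
  have fin: "finite S" "finite K"
    using assms(1,2) by (auto intro: card_ge_0_finite)
  have "S \<subseteq> K"
  proof
    fix v assume v: "v \<in> S"
    show "v \<in> K"
    proof (rule ccontr)
      assume nv: "v \<notin> K"
      \<comment> \<open>Here \<open>3 \<le> card K\<close> enters: besides \<open>v\<close>, the set
        \<open>S\<close> has two further vertices, hence two distinct edges at
        \<open>v\<close>.\<close>
      have "2 \<le> card (S - {v})"
        using assms(1,2) v fin by simp
      then obtain T where "T \<subseteq> S - {v}" "card T = 2"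
        by (meson obtain_subset_with_card_n)
      then obtain u w where uw: "u \<in> S" "w \<in> S" "u \<noteq> v" "w \<noteq> v" "u \<noteq> w"
        by (auto simp: card_2_iff)
      \<comment> \<open>An edge at \<open>v\<close> has an endpoint outside \<open>K\<close>, so the
        only edge it can be is \<open>y\<close>; \<open>min\<close> and \<open>max\<close> put its
        endpoints in increasing order.\<close>
      have y: "(min v t, max v t) = y" if "t \<in> S" "t \<noteq> v" for t
      proof -
        have "(min v t, max v t) \<in> edge_vars S"
          using that v by (auto simp: edge_vars_def min_def max_def)
        moreover have "(min v t, max v t) \<notin> edge_vars K"
          using nv by (auto simp: edge_vars_def min_def max_def)
        ultimately show ?thesis using edges by blast
      qed
      have "(min v u, max v u) = (min v w, max v w)"
        using y[of u] y[of w] uw by simp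
      then show False
        using uw by (auto simp: min_def max_def split: if_splits)
    qed
  qed
  then show ?thesis
    using assms(2) fin by (simp add: card_subset_eq)
qed

lemma restricted_clique_fun_iff:
  assumes "3 \<le> card K" and "K \<subseteq> {1..n}"
  shows "restricted (clique_fun n (card K)) (edge_vars K \<union> {y}) a
    \<longleftrightarrow> (\<forall>x \<in> edge_vars K. a x)"
proof
  assume "restricted (clique_fun n (card K)) (edge_vars K \<union> {y}) a"
  then obtain S where S: "card S = card K"
    and "\<forall>i\<in>S. \<forall>j\<in>S. i < j \<longrightarrow> (if (i, j) \<in> edge_vars K \<union> {y} then a (i, j) else False)"
    unfolding restricted_def clique_fun_def by blast
  \<comment> \<open>Variables outside the restriction set are read as \<open>False\<close>, so a
    clique can only use edges of \<open>K\<close> and \<open>y\<close>.\<close>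
  then have e: "x \<in> edge_vars S \<Longrightarrow> x \<in> edge_vars K \<union> {y} \<and> a x" for x
    unfolding edge_vars_def[of S] by (cases x) (metis case_prodD mem_Collect_eq)
  have "S = K"
    using assms(1) S by (rule clique_in_complete_graph_plus_edge) (use e in blast)
  then show "\<forall>x \<in> edge_vars K. a x"
    using e by blast
next
  assume "\<forall>x \<in> edge_vars K. a x"
  then show "restricted (clique_fun n (card K)) (edge_vars K \<union> {y}) a"
    unfolding restricted_def clique_fun_def
    using assms(2) by (intro exI[of _ K]) (auto simp: edge_vars_def)
qed

text \<open>Comparing orders suffices: an isomorphism would be a bijection onto a group with as many
  elements as there are permutations of \<open>V\<close>. As \<open>\<tau>\<close> does not preserve
  \<open>g\<close>, the carrier of \<open>Aut V g\<close> is a proper subset of this finite set of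
  permutations.\<close>

lemma Aut_not_iso_sym_group:
  assumes "finite V" and "\<tau> permutes V" and "g (\<lambda>v. a (\<tau> v)) \<noteq> g a"
  shows "\<not> (Aut V g \<cong> sym_group (card V))"
proof
  assume "Aut V g \<cong> sym_group (card V)"
  then have "card (carrier (Aut V g)) = card (carrier (sym_group (card V)))"
    by (auto simp: is_iso_def iso_def dest: bij_betw_same_card)
  also have "\<dots> = card {\<sigma>. \<sigma> permutes V}"
    using assms(1) by (simp add: sym_group_def card_permutations)
  finally have "card (carrier (Aut V g)) = card {\<sigma>. \<sigma> permutes V}" .
  moreover have "carrier (Aut V g) \<subset> {\<sigma>. \<sigma> permutes V}"
    using assms(2,3) by (auto simp: Aut_def)
  ultimately show False
    using psubset_card_mono[OF finite_permutations[OF assms(1)]]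
    by (metis less_irrefl)
qed

theorem theorem6:
  fixes n k :: nat and K :: "nat set" and y :: "nat \<times> nat"
  assumes "3 \<le> k" and "k \<le> n"
    and "K \<subseteq> {1..n}" and "card K = k"
    and "y \<in> edge_vars {1..n}" and "y \<notin> edge_vars K"
  shows "\<not> (Aut (edge_vars K \<union> {y}) (restricted (clique_fun n k) (edge_vars K \<union> {y}))
            \<cong> sym_group ((k choose 2) + 1))"
proof -
  let ?V = "edge_vars K \<union> {y}"
  \<comment> \<open>The graph whose edges are exactly those of \<open>K\<close> satisfies the
    conjunction. After exchanging \<open>x\<close> and \<open>y\<close>, the variable
    \<open>x\<close> takes the value of \<open>y\<close>, which is \<open>False\<close>.\<close>
  let ?a = "\<lambda>x. x \<in> edge_vars K"
  have finK: "finite K"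
    using assms(3) by (rule finite_subset) simp
  have finE: "finite (edge_vars K)"
    using finK by (rule finite_edge_vars)
  have card_V: "card ?V = (k choose 2) + 1"
    using assms(4,6) finE by (simp add: card_edge_vars finK)
  have "card (edge_vars K) > 0"
    using assms(1,4) by (simp add: card_edge_vars finK)
  then obtain x where x: "x \<in> edge_vars K"
    by (metis all_not_in_conv card_gt_0_iff)
  have f_iff: "restricted (clique_fun n k) ?V b \<longleftrightarrow> (\<forall>x \<in> edge_vars K. b x)" for b
    using restricted_clique_fun_iff assms(1,3,4) by blast
  have "\<not> (Aut ?V (restricted (clique_fun n k) ?V) \<cong> sym_group (card ?V))"
  proof (rule Aut_not_iso_sym_group)
    show "finite ?V"
      using finE by simp
    show "transpose x y permutes ?V"
      using x by (intro permutes_swap_id) auto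
    show "restricted (clique_fun n k) ?V (\<lambda>v. ?a (transpose x y v))
      \<noteq> restricted (clique_fun n k) ?V ?a"
      unfolding f_iff using x assms(6) by (auto intro!: bexI[of _ x])
  qed
  then show ?thesis
    unfolding card_V .
qed

end
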